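(* Let $i \ge 3$ be an integer and let $n = 2i$. Then the automorphism group of the Johnson graph $J(n,i)$ is $S_n \times \langle T \rangle$, where $T$ is the complementation map $A \mapsto A^c = \{1,\ldots,n\}\setminus A$ on the vertices of $J(n,i)$ and $S_n$ is identified with the group $\{\rho_\theta : \theta \in S_n\}$ of permutations of the vertex set induced by $S_n$. That is, $\operatorname{Aut}(J(n,i))$ is the internal direct product of its subgroups $\{\rho_\theta : \theta \in S_n\} \cong S_n$ and $\langle T \rangle$.
   Context: The Johnson graph $J(n,i)$ is the graph whose vertices are the $i$-element subsets of $\{1,\ldots,n\}$, with two vertices $A, B$ adjacent if and only if $|A \cap B| = i-1$. The automorphism group of a graph is the group of all permutations of its vertex set that preserve adjacency and nonadjacency. For $\theta \in S_n$ (the symmetric group on $\{1,\ldots,n\}$), $\rho_\theta$ denotes the permutation $A \mapsto \theta(A) = \{\theta(a) : a \in A\}$ of the vertex set of $J(n,i)$. When $n = 2i$, the complement $A^c$ of an $i$-element subset is again an $i$-element subset, so $T$ is a permutation of the vertex set. *)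

theory Defs
  imports "HOL-Algebra.Bij" "HOL-Algebra.Sym_Groups" "Graph_Theory.Pair_Digraph"
begin

text \<open>
  An undirected graph is represented by a symmetric set of ordered pairs of vertices
  (\<^locale>\<open>pair_graph\<close>).  The condition \<open>card (A \<inter> B) + 1 = i\<close> expresses
  \<open>|A \<inter> B| = i - 1\<close> without truncated subtraction; it already excludes loops.
\<close>

definition johnson_graph :: "nat \<Rightarrow> nat \<Rightarrow> nat set pair_pre_digraph" where
  "johnson_graph n i =
    \<lparr>pverts = {A. A \<subseteq> {1..n} \<and> card A = i},
     parcs = {(A, B). A \<subseteq> {1..n} \<and> card A = i \<and> B \<subseteq> {1..n} \<and> card B = i \<and>
                      card (A \<inter> B) + 1 = i}\<rparr>"

lemma johnson_graph_arc_iff: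
  "(A, B) \<in> parcs (johnson_graph n i) \<longleftrightarrow>
    A \<in> pverts (johnson_graph n i) \<and> B \<in> pverts (johnson_graph n i) \<and> card (A \<inter> B) + 1 = i"
  by (simp add: johnson_graph_def)

lemma pair_graph_johnson_graph: "pair_graph (johnson_graph n i)"
proof
  have "pverts (johnson_graph n i) \<subseteq> Pow {1..n}"
    by (auto simp: johnson_graph_def)
  then show fin: "finite (pverts (johnson_graph n i))"
    by (rule finite_subset) simp
  have "parcs (johnson_graph n i) \<subseteq> pverts (johnson_graph n i) \<times> pverts (johnson_graph n i)"
    by (auto simp: johnson_graph_arc_iff)
  then show "finite (parcs (johnson_graph n i))"
    by (rule finite_subset) (simp add: fin)
  show "symmetric (with_proj (johnson_graph n i))"
    unfolding symmetric_def with_proj_simps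
    by (rule symI) (simp add: johnson_graph_arc_iff Int_commute)
next
  fix e assume "e \<in> parcs (johnson_graph n i)"
  moreover obtain A B where "e = (A, B)" by fastforce
  ultimately have *: "e = (A, B)" "A \<in> pverts (johnson_graph n i)"
      "B \<in> pverts (johnson_graph n i)" "card (A \<inter> B) + 1 = i"
    by (simp_all add: johnson_graph_arc_iff)
  from * show "fst e \<in> pverts (johnson_graph n i)" "snd e \<in> pverts (johnson_graph n i)"
    by simp_all
  from * have "card A = i" by (simp add: johnson_graph_def)
  show "fst e \<noteq> snd e"
  proof
    assume "fst e = snd e"
    with *(1) have "A \<inter> B = A" by simp
    with *(4) have "card A + 1 = i" by (simp only:)
    with \<open>card A = i\<close> show False by linarith
  qed
qed

definition graph_automorphisms :: "'a pair_pre_digraph \<Rightarrow> ('a \<Rightarrow> 'a) set" where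
  "graph_automorphisms G =
    {f \<in> Bij (pverts G). \<forall>u\<in>pverts G. \<forall>v\<in>pverts G. (f u, f v) \<in> parcs G \<longleftrightarrow> (u, v) \<in> parcs G}"

definition Aut_graph :: "'a pair_pre_digraph \<Rightarrow> ('a \<Rightarrow> 'a) monoid" where
  "Aut_graph G = (BijGroup (pverts G)) \<lparr>carrier := graph_automorphisms G\<rparr>"

text \<open>
  Elements of \<^term>\<open>BijGroup V\<close> are extensional functions, so the maps below are restricted
  to the vertex set.
\<close>

definition johnson_rho :: "nat \<Rightarrow> nat \<Rightarrow> (nat \<Rightarrow> nat) \<Rightarrow> (nat set \<Rightarrow> nat set)" where
  "johnson_rho n i \<theta> = (\<lambda>A\<in>pverts (johnson_graph n i). \<theta> ` A)"

definition johnson_compl :: "nat \<Rightarrow> nat \<Rightarrow> (nat set \<Rightarrow> nat set)" where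
  "johnson_compl n i = (\<lambda>A\<in>pverts (johnson_graph n i). {1..n} - A)"

definition internal_direct_product :: "('a, 'b) monoid_scheme \<Rightarrow> 'a set \<Rightarrow> 'a set \<Rightarrow> bool" where
  "internal_direct_product G H K \<longleftrightarrow>
    H \<lhd> G \<and> K \<lhd> G \<and> H \<inter> K = {\<one>\<^bsub>G\<^esub>} \<and> H <#>\<^bsub>G\<^esub> K = carrier G"

end

theory Submission
  imports Defs
begin

text \<open>
  The neighbours of a vertex \<open>A\<close> are the sets \<open>A - {a} \<union> {b}\<close> with \<open>a \<in> A\<close>, \<open>b \<notin> A\<close>; among
  themselves they form the grid \<open>A \<times> A\<^sup>c\<close>, two of them being adjacent iff they agree in exactly one
  coordinate. An automorphism \<open>f\<close> maps the grid at \<open>A\<close> to the grid at \<open>f A\<close>, so it acts on it as a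
  product \<open>\<sigma> \<times> \<tau>\<close>, possibly followed by exchanging the two coordinates. Complementation exchanges
  the coordinates, so for \<open>f\<close> or for \<open>T \<circ> f\<close> there is no exchange; gluing \<open>\<sigma>\<close> and \<open>\<tau>\<close> then gives
  a permutation \<open>\<theta>\<close> of \<open>{1..n}\<close> such that \<open>\<rho>\<^sub>\<theta>\<close> agrees with the automorphism on \<open>A\<close> and on its
  neighbours. Finally, an automorphism fixing a vertex and all its neighbours is trivial: a vertex \<open>C\<close>
  at distance 2 from \<open>A\<close> is the only vertex besides \<open>A\<close> that is adjacent to the four common
  neighbours of \<open>A\<close> and \<open>C\<close>, hence it is fixed too, and the graph is connected.
\<close>

abbreviation exchange :: "'a set \<Rightarrow> 'a \<Rightarrow> 'a \<Rightarrow> 'a set" where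
  "exchange A a b \<equiv> insert b (A - {a})"

lemma johnson_verts_iff: "A \<in> pverts (johnson_graph n i) \<longleftrightarrow> A \<subseteq> {1..n} \<and> card A = i"
  by (simp add: johnson_graph_def)

lemma johnson_vert_finite: "A \<in> pverts (johnson_graph n i) \<Longrightarrow> finite A"
  by (metis finite_atLeastAtMost finite_subset johnson_verts_iff)

section \<open>Neighbourhoods as grids\<close>

lemma card_exchange:
  assumes "finite A" "a \<in> A" "b \<notin> A"
  shows "card (exchange A a b) = card A"
  using assms card_Suc_Diff1[of A a] by simp

lemma exchange_vert:
  assumes "A \<in> pverts (johnson_graph n i)" "a \<in> A" "b \<in> {1..n} - A"
  shows "exchange A a b \<in> pverts (johnson_graph n i)"
  using assms card_exchange[of A a b] johnson_vert_finite[OF assms(1)]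
  unfolding johnson_verts_iff by auto

text \<open>The coordinates can be read off the set: \<open>a\<close> is the only element of
  \<open>A\<close> that it lacks, \<open>b\<close> the only element outside \<open>A\<close> that it
  contains.\<close>

lemma exchange_eq_iff:
  assumes "a \<in> A" "a' \<in> A" "b \<notin> A" "b' \<notin> A"
  shows "exchange A a b = exchange A a' b' \<longleftrightarrow> a = a' \<and> b = b'"
proof
  assume eq: "exchange A a b = exchange A a' b'"
  then have "b \<in> exchange A a' b'" "a \<notin> exchange A a' b'" using assms by auto
  then show "a = a' \<and> b = b'" using assms by auto
qed simp

lemma exchange_arc:
  assumes "A \<in> pverts (johnson_graph n i)" "a \<in> A" "b \<in> {1..n} - A"
  shows "(A, exchange A a b) \<in> parcs (johnson_graph n i)"
proof -
  have "A \<inter> exchange A a b = A - {a}" using assms by auto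
  moreover have "card (A - {a}) + 1 = i"
    using assms johnson_vert_finite[OF assms(1)] card_Suc_Diff1[of A a]
    by (simp add: johnson_verts_iff)
  ultimately show ?thesis
    using assms exchange_vert[OF assms] by (simp add: johnson_graph_arc_iff)
qed

text \<open>Both sets have \<open>i\<close> elements and share \<open>i - 1\<close>, so each
  difference is a singleton. Together with \<open>exchange_arc\<close> this identifies the
  neighbours of \<open>A\<close> with the cells of a grid.\<close>

lemma johnson_arcE:
  assumes "(A, B) \<in> parcs (johnson_graph n i)"
  obtains a b where "a \<in> A" "b \<in> {1..n} - A" "B = exchange A a b"
proof -
  have V: "A \<subseteq> {1..n}" "card A = i" "B \<subseteq> {1..n}" "card B = i" and c: "card (A \<inter> B) + 1 = i"
    and fin: "finite A" "finite B"
    using assms johnson_vert_finite by (auto simp: johnson_graph_arc_iff johnson_verts_iff)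
  have "card (A - B) = 1" "card (B - A) = 1"
    using V c fin card_Diff_subset_Int[of A B] card_Diff_subset_Int[of B A]
    by (auto simp: Int_commute)
  then obtain a b where "A - B = {a}" "B - A = {b}"
    by (meson card_1_singletonE)
  then show thesis using V by (intro that[of a b]) auto
qed

text \<open>The intersection is \<open>A - {a, a'}\<close>, enlarged by the new element when
  \<open>b = b'\<close>. Its size is \<open>i\<close>, \<open>i - 1\<close> or \<open>i - 2\<close>
  according as two, one or none of the coordinates agree.\<close>

lemma exchange_exchange_arc_iff:
  assumes A: "A \<in> pverts (johnson_graph n i)" and ab: "a \<in> A" "b \<in> {1..n} - A"
    and ab': "a' \<in> A" "b' \<in> {1..n} - A"
  shows "(exchange A a b, exchange A a' b') \<in> parcs (johnson_graph n i)
    \<longleftrightarrow> ((a = a') \<noteq> (b = b'))"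
proof -
  have fin: "finite A" and cA: "card A = i" using A johnson_vert_finite by (auto simp: johnson_verts_iff)
  have "card (exchange A a b \<inter> exchange A a' b') = card (A - {a, a'}) + of_bool (b = b')"
  proof (cases "b = b'")
    case True
    then have "exchange A a b \<inter> exchange A a' b' = insert b (A - {a, a'})" by auto
    then show ?thesis using True ab fin by simp
  next
    case False
    then have "exchange A a b \<inter> exchange A a' b' = A - {a, a'}" using ab ab' by auto
    then show ?thesis using False by simp
  qed
  moreover have "card (A - {a, a'}) + (if a = a' then 1 else 2) = i"
  proof -
    \<comment> \<open>For \<open>a \<noteq> a'\<close> this yields \<open>2 \<le> i\<close>, which
      keeps the subtraction below from being truncated.\<close>
    have "card {a, a'} \<le> card A" using fin ab ab' by (intro card_mono) auto
    then show ?thesis using fin ab ab' cA card_Diff_subset[of "{a, a'}" A] by auto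
  qed
  ultimately show ?thesis
    using exchange_vert[OF A ab] exchange_vert[OF A ab']
    by (auto simp: johnson_graph_arc_iff split: if_splits)
qed

section \<open>Rigidity\<close>

lemma graph_automorphismD:
  assumes "f \<in> graph_automorphisms G"
  shows "bij_betw f (pverts G) (pverts G)" "f \<in> extensional (pverts G)"
    "\<And>u. u \<in> pverts G \<Longrightarrow> f u \<in> pverts G"
    "\<And>u v. u \<in> pverts G \<Longrightarrow> v \<in> pverts G \<Longrightarrow> (f u, f v) \<in> parcs G \<longleftrightarrow> (u, v) \<in> parcs G"
  using assms unfolding graph_automorphisms_def Bij_def by (auto dest: bij_betwE)

text \<open>The four sets \<open>exchange A x y\<close> are the corners of a rectangle in the grid
  at \<open>A\<close>. Counting the elements of \<open>D\<close> in \<open>R = A - {a, a'}\<close>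
  and among the four points leaves two common neighbours, so an automorphism fixing the corners and
  one of these must fix the other.\<close>

lemma common_neighbour_cases:
  assumes V: "A \<in> pverts (johnson_graph n i)" and D: "D \<in> pverts (johnson_graph n i)"
    and a: "a \<in> A" "a' \<in> A" "a \<noteq> a'"
    and b: "b \<in> {1..n} - A" "b' \<in> {1..n} - A" "b \<noteq> b'"
    and adj: "\<And>x y. x \<in> {a, a'} \<Longrightarrow> y \<in> {b, b'} \<Longrightarrow> (D, exchange A x y) \<in> parcs (johnson_graph n i)"
  shows "D = A \<or> D = exchange (exchange A a b) a' b'"
proof -
  define R where "R = A - {a, a'}"
  have fin: "finite A" "finite D" "finite R" and cA: "card A = i" and cD: "card D = i"
    using V D johnson_vert_finite by (auto simp: johnson_verts_iff R_def)
  have AR: "A = insert a (insert a' R)" "a \<notin> R" "a' \<notin> R" "b \<notin> R" "b' \<notin> R"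
    using a b by (auto simp: R_def)
  have cR: "card R + 2 = i" using cA AR a fin by simp
  have count: "card (D \<inter> insert x (insert y R)) = of_bool (x \<in> D) + of_bool (y \<in> D) + card (D \<inter> R)"
    if "x \<notin> R" "y \<notin> R" "x \<noteq> y" for x y
    using that fin by (auto simp: Int_insert_right)
  have ne: "a \<noteq> b" "a \<noteq> b'" "a' \<noteq> b" "a' \<noteq> b'" using a b by auto
  have ex: "exchange A a b = insert a' (insert b R)" "exchange A a b' = insert a' (insert b' R)"
    "exchange A a' b = insert a (insert b R)" "exchange A a' b' = insert a (insert b' R)"
    using a AR ne by auto
  have eqs: "of_bool (a' \<in> D) + of_bool (b \<in> D) + card (D \<inter> R) + 1 = i"
    "of_bool (a' \<in> D) + of_bool (b' \<in> D) + card (D \<inter> R) + 1 = i"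
    "of_bool (a \<in> D) + of_bool (b \<in> D) + card (D \<inter> R) + 1 = i"
    "of_bool (a \<in> D) + of_bool (b' \<in> D) + card (D \<inter> R) + 1 = i"
    using adj[of a b, unfolded ex johnson_graph_arc_iff] adj[of a b', unfolded ex johnson_graph_arc_iff]
      adj[of a' b, unfolded ex johnson_graph_arc_iff] adj[of a' b', unfolded ex johnson_graph_arc_iff]
      count[of a' b] count[of a' b'] count[of a b] count[of a b'] AR(2-) ne
    by simp_all
  \<comment> \<open>This bound excludes the case that \<open>D\<close> contains all four points and
    misses one element of \<open>R\<close>: such a \<open>D\<close> would have \<open>i + 1\<close>
    elements.\<close>
  have "card (D \<inter> insert a (insert a' (insert b (insert b' R)))) \<le> i"
    using fin cD by (metis Int_lower1 card_mono)
  moreover have "card (D \<inter> insert a (insert a' (insert b (insert b' R)))) =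
    of_bool (a \<in> D) + of_bool (a' \<in> D) + of_bool (b \<in> D) + of_bool (b' \<in> D) + card (D \<inter> R)"
    using AR ne a b fin by (auto simp: Int_insert_right)
  ultimately have tot: "of_bool (a \<in> D) + of_bool (a' \<in> D) + of_bool (b \<in> D) + of_bool (b' \<in> D)
      + card (D \<inter> R) \<le> i" by simp
  have "card (D \<inter> R) \<le> card R" using fin by (simp add: card_mono)
  \<comment> \<open>The four equations force \<open>a \<in> D \<longleftrightarrow> a' \<in> D\<close> and \<open>b \<in> D \<longleftrightarrow> b' \<in> D\<close>; with the bound on
    \<open>card D\<close>, exactly one of the two pairs lies in \<open>D\<close>.\<close>
  with eqs tot cR have r: "card (D \<inter> R) = card R"
    and alt: "(a \<in> D \<and> a' \<in> D) \<or> (b \<in> D \<and> b' \<in> D)"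
    by (auto simp: of_bool_def split: if_splits)
  have "R \<subseteq> D" using r fin by (metis Int_lower2 card_subset_eq inf.orderI inf_commute)
  with alt consider "A \<subseteq> D" | "insert b (insert b' R) \<subseteq> D" using AR by blast
  then show ?thesis
  proof cases
    case 1
    then have "A = D" using fin cA cD by (simp add: card_subset_eq)
    then show ?thesis by simp
  next
    case 2
    have "card (insert b (insert b' R)) = card D" using cR cD AR b fin by simp
    with 2 have "insert b (insert b' R) = D" using fin by (simp add: card_subset_eq)
    moreover have "exchange (exchange A a b) a' b' = insert b (insert b' R)"
      using AR ne a by auto
    ultimately show ?thesis by simp
  qed
qed

text \<open>This is the propagation step of rigidity: fixing a vertex with all its neighbours passes
  from \<open>A\<close> to any neighbour \<open>B\<close>. If \<open>C\<close> is at distance two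
  from \<open>A\<close>, then \<open>f C\<close> is adjacent to the same four corners as
  \<open>C\<close>, so it is \<open>A\<close> or \<open>C\<close>, and injectivity excludes
  \<open>A\<close>.\<close>

lemma automorphism_fixes_neighbourhoods:
  assumes f: "f \<in> graph_automorphisms (johnson_graph n i)"
    and V: "A \<in> pverts (johnson_graph n i)" and fA: "f A = A"
    and nb: "\<And>B. (A, B) \<in> parcs (johnson_graph n i) \<Longrightarrow> f B = B"
    and AB: "(A, B) \<in> parcs (johnson_graph n i)" and BC: "(B, C) \<in> parcs (johnson_graph n i)"
  shows "f C = C"
proof -
  note fD = graph_automorphismD[OF f]
  obtain a b where ab: "a \<in> A" "b \<in> {1..n} - A" "B = exchange A a b" by (rule johnson_arcE[OF AB])
  obtain c d where cd: "c \<in> B" "d \<in> {1..n} - B" "C = exchange B c d" by (rule johnson_arcE[OF BC])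
  have VC: "C \<in> pverts (johnson_graph n i)" using BC by (simp add: johnson_graph_arc_iff)
  \<comment> \<open>The second exchange undoes the first, undoes half of it and so leaves a single
    exchange, or involves two new elements.\<close>
  consider "C = A" | "(A, C) \<in> parcs (johnson_graph n i)"
    | "c \<in> A" "c \<noteq> a" "d \<in> {1..n} - A" "d \<noteq> b"
  proof -
    consider "c = b" "d = a" | "c = b" "d \<noteq> a" | "c \<noteq> b" "d = a" | "c \<noteq> b" "d \<noteq> a" by blast
    then show thesis
    proof cases
      case 1 then show ?thesis using that(1) ab cd by auto
    next
      case 2
      then have "C = exchange A a d" "d \<in> {1..n} - A" using ab cd by auto
      then show ?thesis using that(2) exchange_arc[OF V ab(1)] by simp
    next
      case 3
      then have "C = exchange A c b" "c \<in> A" using ab cd by auto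
      then show ?thesis using that(2) exchange_arc[OF V _ ab(2)] by simp
    next
      case 4 then show ?thesis using that(3) ab cd by auto
    qed
  qed
  then show ?thesis
  proof cases
    case 3
    have C: "C = exchange (exchange A a b) c d" using ab cd by simp
    have "(f C, exchange A x y) \<in> parcs (johnson_graph n i)" if "x \<in> {a, c}" "y \<in> {b, d}" for x y
    proof -
      have xy: "x \<in> A" "y \<in> {1..n} - A" using that 3 ab by auto
      have CX: "C \<inter> exchange A x y = insert y (A - {a, c})"
        using that 3 ab by (auto simp: C)
      have "card (A - {a, c}) + 2 = i"
      proof -
        have "card {a, c} \<le> card A" using johnson_vert_finite[OF V] ab 3 by (intro card_mono) auto
        then show ?thesis using johnson_vert_finite[OF V] ab 3 V card_Diff_subset[of "{a, c}" A]
          by (auto simp: johnson_verts_iff)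
      qed
      then have "card (C \<inter> exchange A x y) + 1 = i"
        using xy johnson_vert_finite[OF V] unfolding CX by simp
      then have "(C, exchange A x y) \<in> parcs (johnson_graph n i)"
        using VC exchange_vert[OF V xy] by (simp add: johnson_graph_arc_iff)
      then show ?thesis
        using fD(4)[OF VC exchange_vert[OF V xy]] nb[OF exchange_arc[OF V xy]] by simp
    qed
    then have "f C = A \<or> f C = C"
      using common_neighbour_cases[OF V fD(3)[OF VC] ab(1) 3(1) _ ab(2) 3(3)] 3 C by metis
    moreover have "C \<noteq> A" using 3 ab by (auto simp: C)
    ultimately show ?thesis
      using fA fD(1) V VC by (metis bij_betw_inv_into_left)
  qed (use fA nb in auto)
qed

text \<open>The base vertex \<open>A\<close> moves towards \<open>X\<close>: trading an element of
  \<open>A - X\<close> for one of \<open>X - A\<close> lowers \<open>card (A - X)\<close> by one,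
  and \<open>automorphism_fixes_neighbourhoods\<close> carries the hypotheses to the new base
  vertex.\<close>

lemma automorphism_rigid:
  assumes f: "f \<in> graph_automorphisms (johnson_graph n i)"
    and "A \<in> pverts (johnson_graph n i)" "f A = A"
    and "\<And>B. (A, B) \<in> parcs (johnson_graph n i) \<Longrightarrow> f B = B"
    and X: "X \<in> pverts (johnson_graph n i)"
  shows "f X = X"
  using assms(2-4)
proof (induction "card (A - X)" arbitrary: A)
  case 0
  then have "A \<subseteq> X" using johnson_vert_finite by simp
  then have "A = X" using 0 X johnson_vert_finite[OF X] by (simp add: card_subset_eq johnson_verts_iff)
  then show ?case using 0 by simp
next
  case (Suc k)
  note V = Suc.prems(1)
  have fin: "finite A" "finite X" using V X johnson_vert_finite by auto
  have "card (X - A) = card (A - X)"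
    using V X fin card_Diff_subset_Int[of A X] card_Diff_subset_Int[of X A]
    by (simp add: johnson_verts_iff Int_commute)
  with Suc.hyps(2) have "A - X \<noteq> {}" "X - A \<noteq> {}"
    by (metis card.empty nat.distinct(1))+
  then obtain a b where ab: "a \<in> A - X" "b \<in> X - A" by auto
  then have b: "b \<in> {1..n} - A" using X by (auto simp: johnson_verts_iff)
  have arc: "(A, exchange A a b) \<in> parcs (johnson_graph n i)"
    using exchange_arc[OF V _ b] ab by simp
  have "exchange A a b - X = (A - X) - {a}" using ab by auto
  then have "k = card (exchange A a b - X)" using Suc.hyps(2) ab fin by simp
  then show ?case
  proof (rule Suc.hyps(1))
    show "exchange A a b \<in> pverts (johnson_graph n i)"
      using arc by (simp add: johnson_graph_arc_iff)
    show "f (exchange A a b) = exchange A a b" using arc Suc.prems by blast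
    show "f C = C" if "(exchange A a b, C) \<in> parcs (johnson_graph n i)" for C
      using automorphism_fixes_neighbourhoods[OF f Suc.prems arc that] .
  qed
qed

section \<open>Collinearity-preserving maps between grids\<close>

text \<open>Here \<open>(g, h)\<close> sends the cell \<open>(a, b)\<close> to a cell of another
  grid, respecting collinearity. Once two cells of row \<open>a0\<close> have images that agree in
  \<open>g\<close>, the whole row is forced to follow, and then all columns and rows.\<close>

lemma grid_map_straight:
  assumes adj: "\<And>a b a' b'. \<lbrakk>a \<in> X; b \<in> Y; a' \<in> X; b' \<in> Y\<rbrakk> \<Longrightarrow>
      ((g a b = g a' b') \<noteq> (h a b = h a' b')) \<longleftrightarrow> ((a = a') \<noteq> (b = b'))"
    and inj: "\<And>a b a' b'. \<lbrakk>a \<in> X; b \<in> Y; a' \<in> X; b' \<in> Y; g a b = g a' b'; h a b = h a' b'\<rbrakk> \<Longrightarrow> a = a' \<and> b = b'"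
    and a0: "a0 \<in> X" and b: "b0 \<in> Y" "b1 \<in> Y" "b0 \<noteq> b1" and eq: "g a0 b0 = g a0 b1"
  shows "\<exists>\<sigma> \<tau>. \<forall>a\<in>X. \<forall>b\<in>Y. g a b = \<sigma> a \<and> h a b = \<tau> b"
proof -
  \<comment> \<open>A cell leaving the image line would agree in \<open>h\<close> with the images of
    both \<open>(a0, b0)\<close> and \<open>(a0, b1)\<close>, which would then coincide.\<close>
  have row: "g a0 b = g a0 b0" if "b \<in> Y" for b
  proof (rule ccontr)
    assume "g a0 b \<noteq> g a0 b0"
    then have "h a0 b = h a0 b0" "h a0 b = h a0 b1"
      using adj[OF a0 that a0 b(1)] adj[OF a0 that a0 b(2)] eq by auto
    then show False using inj[OF a0 b(1) a0 b(2) eq] b by auto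
  qed
  have col: "h a b = h a0 b" if "a \<in> X" "b \<in> Y" for a b
  proof (cases "a = a0")
    case False
    obtain b' where b': "b' \<in> Y" "b' \<noteq> b" using b by blast
    \<comment> \<open>Otherwise \<open>(a, b)\<close> and \<open>(a0, b')\<close>, which are neither
      equal nor collinear, would have images agreeing in \<open>g\<close>.\<close>
    have "g a b \<noteq> g a0 b"
    proof
      assume "g a b = g a0 b"
      then have "g a b = g a0 b'" using row that b' by simp
      then show False using adj[OF that a0 b'(1)] inj[OF that a0 b'(1)] False b'(2) by auto
    qed
    then show ?thesis using adj[OF that a0 that(2)] False by auto
  qed simp
  \<comment> \<open>On row \<open>a0\<close> the cells are told apart by \<open>h\<close>; by
    \<open>col\<close> the same holds on row \<open>a\<close>, so collinear images there must agree
    in \<open>g\<close>.\<close>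
  have "g a b = g a b0" if "a \<in> X" "b \<in> Y" for a b
  proof (cases "b = b0")
    case False
    then have "h a0 b \<noteq> h a0 b0" using row[OF that(2)] inj[OF a0 that(2) a0 b(1)] by auto
    then have "h a b \<noteq> h a b0" using col that b by simp
    then show ?thesis using adj[OF that that(1) b(1)] False by auto
  qed simp
  with col show ?thesis by (intro exI[of _ "\<lambda>a. g a b0"] exI[of _ "h a0"]) blast
qed

text \<open>The collinear cells \<open>(a0, b0)\<close> and \<open>(a0, b1)\<close> have images
  agreeing in exactly one of \<open>g\<close> and \<open>h\<close>; exchanging the roles of
  \<open>g\<close> and \<open>h\<close> reduces the crossed case to the straight one.\<close>

lemma grid_map_cases:
  assumes adj: "\<And>a b a' b'. \<lbrakk>a \<in> X; b \<in> Y; a' \<in> X; b' \<in> Y\<rbrakk> \<Longrightarrow>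
      ((g a b = g a' b') \<noteq> (h a b = h a' b')) \<longleftrightarrow> ((a = a') \<noteq> (b = b'))"
    and inj: "\<And>a b a' b'. \<lbrakk>a \<in> X; b \<in> Y; a' \<in> X; b' \<in> Y; g a b = g a' b'; h a b = h a' b'\<rbrakk> \<Longrightarrow> a = a' \<and> b = b'"
    and a0: "a0 \<in> X" and b: "b0 \<in> Y" "b1 \<in> Y" "b0 \<noteq> b1"
  obtains (straight) \<sigma> \<tau> where "\<And>a b. a \<in> X \<Longrightarrow> b \<in> Y \<Longrightarrow> g a b = \<sigma> a \<and> h a b = \<tau> b"
  | (crossed) \<sigma> \<tau> where "\<And>a b. a \<in> X \<Longrightarrow> b \<in> Y \<Longrightarrow> h a b = \<sigma> a \<and> g a b = \<tau> b"
proof (cases "g a0 b0 = g a0 b1")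
  case True
  have "\<exists>\<sigma> \<tau>. \<forall>a\<in>X. \<forall>b\<in>Y. g a b = \<sigma> a \<and> h a b = \<tau> b"
    by (rule grid_map_straight[of X Y g h, OF adj inj a0 b True])
  then show ?thesis using straight by blast
next
  case False
  then have eq: "h a0 b0 = h a0 b1" using adj[OF a0 b(1) a0 b(2)] b(3) by auto
  have "\<exists>\<sigma> \<tau>. \<forall>a\<in>X. \<forall>b\<in>Y. h a b = \<sigma> a \<and> g a b = \<tau> b"
  proof (rule grid_map_straight[of X Y h g, OF _ _ a0 b eq])
    show "((h a b = h a' b') \<noteq> (g a b = g a' b')) \<longleftrightarrow> ((a = a') \<noteq> (b = b'))"
      if "a \<in> X" "b \<in> Y" "a' \<in> X" "b' \<in> Y" for a b a' b'
      using adj[OF that] by metis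
  qed (use inj in blast)
  then show ?thesis using crossed by blast
qed


section \<open>The automorphism group\<close>

lemma rho_apply: "A \<in> pverts (johnson_graph n i) \<Longrightarrow> johnson_rho n i \<theta> A = \<theta> ` A"
  by (simp add: johnson_rho_def)

lemma compl_apply: "A \<in> pverts (johnson_graph n i) \<Longrightarrow> johnson_compl n i A = {1..n} - A"
  by (simp add: johnson_compl_def)

lemma image_vert:
  assumes "\<theta> permutes {1..n}" "A \<in> pverts (johnson_graph n i)"
  shows "\<theta> ` A \<in> pverts (johnson_graph n i)"
  using assms unfolding johnson_verts_iff
  by (metis card_image image_mono permutes_image permutes_inj_on)

lemma compl_vert:
  assumes "n = 2 * i" "A \<in> pverts (johnson_graph n i)"
  shows "{1..n} - A \<in> pverts (johnson_graph n i)"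
  using assms johnson_vert_finite[OF assms(2)]
  by (simp add: johnson_verts_iff card_Diff_subset)

lemma rho_automorphism:
  assumes \<theta>: "\<theta> permutes {1..n}"
  shows "johnson_rho n i \<theta> \<in> graph_automorphisms (johnson_graph n i)"
proof -
  let ?V = "pverts (johnson_graph n i)"
  have "bij_betw (johnson_rho n i \<theta>) ?V ?V"
  proof (rule bij_betw_byWitness[where f' = "johnson_rho n i (inv' \<theta>)"])
    note vert = image_vert[OF \<theta>] image_vert[OF permutes_inv[OF \<theta>]]
    show "\<forall>A\<in>?V. johnson_rho n i (inv' \<theta>) (johnson_rho n i \<theta> A) = A"
      and "\<forall>A\<in>?V. johnson_rho n i \<theta> (johnson_rho n i (inv' \<theta>) A) = A"
      using vert by (simp_all add: rho_apply image_comp permutes_inv_o[OF \<theta>] del: One_nat_def)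
    show "johnson_rho n i \<theta> ` ?V \<subseteq> ?V" "johnson_rho n i (inv' \<theta>) ` ?V \<subseteq> ?V"
      using vert by (auto simp: rho_apply)
  qed
  moreover have "(johnson_rho n i \<theta> A, johnson_rho n i \<theta> B) \<in> parcs (johnson_graph n i)
      \<longleftrightarrow> (A, B) \<in> parcs (johnson_graph n i)" if "A \<in> ?V" "B \<in> ?V" for A B
  proof -
    have "card (\<theta> ` A \<inter> \<theta> ` B) = card (A \<inter> B)"
      using permutes_inj[OF \<theta>] by (metis card_image image_Int inj_on_subset subset_UNIV)
    then show ?thesis using that by (simp add: johnson_graph_arc_iff rho_apply image_vert[OF \<theta>])
  qed
  ultimately show ?thesis
    by (auto simp: graph_automorphisms_def Bij_def johnson_rho_def)
qed

text \<open>By inclusion-exclusion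
  \<open>card (A \<union> B) + card (A \<inter> B) = 2 * i = n\<close>, so the complements of
  \<open>A\<close> and \<open>B\<close> meet in as many elements as \<open>A\<close> and
  \<open>B\<close> do.\<close>

lemma compl_automorphism:
  assumes n: "n = 2 * i"
  shows "johnson_compl n i \<in> graph_automorphisms (johnson_graph n i)"
proof -
  let ?V = "pverts (johnson_graph n i)"
  have dc: "{1..n} - ({1..n} - A) = A" if "A \<in> ?V" for A
    using that by (auto simp: johnson_verts_iff)
  have "bij_betw (johnson_compl n i) ?V ?V"
    using compl_vert[OF n] dc
    by (intro bij_betw_byWitness[where f' = "johnson_compl n i"]) (auto simp: compl_apply)
  moreover have "(johnson_compl n i A, johnson_compl n i B) \<in> parcs (johnson_graph n i)
      \<longleftrightarrow> (A, B) \<in> parcs (johnson_graph n i)" if "A \<in> ?V" "B \<in> ?V" for A B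
  proof -
    have fin: "finite A" "finite B" using that johnson_vert_finite by auto
    have sub: "A \<union> B \<subseteq> {1..n}" using that by (auto simp: johnson_verts_iff)
    have "({1..n} - A) \<inter> ({1..n} - B) = {1..n} - (A \<union> B)" by auto
    then have "card (({1..n} - A) \<inter> ({1..n} - B)) = n - card (A \<union> B)"
      using fin sub by (simp add: card_Diff_subset)
    moreover have "card (A \<union> B) + card (A \<inter> B) = n"
      using card_Un_Int[OF fin] that n by (simp add: johnson_verts_iff)
    ultimately have "card (({1..n} - A) \<inter> ({1..n} - B)) = card (A \<inter> B)" by simp
    then show ?thesis using that compl_vert[OF n] by (simp add: johnson_graph_arc_iff compl_apply)
  qed
  ultimately show ?thesis
    by (auto simp: graph_automorphisms_def Bij_def johnson_compl_def)
qed

section \<open>The group of automorphisms of a graph\<close>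

lemma compose_graph_automorphisms:
  assumes f: "f \<in> graph_automorphisms G" and g: "g \<in> graph_automorphisms G"
  shows "compose (pverts G) f g \<in> graph_automorphisms G"
proof -
  have "compose (pverts G) f g \<in> Bij (pverts G)"
    using f g by (auto simp: graph_automorphisms_def intro: compose_Bij)
  then show ?thesis
    using graph_automorphismD(3,4)[OF f] graph_automorphismD(3,4)[OF g]
    by (auto simp: graph_automorphisms_def compose_eq)
qed

lemma subgroup_graph_automorphisms:
  "subgroup (graph_automorphisms G) (BijGroup (pverts G))"
proof (rule group.subgroupI[OF group_BijGroup])
  show "graph_automorphisms G \<subseteq> carrier (BijGroup (pverts G))"
    by (auto simp: graph_automorphisms_def BijGroup_def)
  have "(\<lambda>x\<in>pverts G. x) \<in> graph_automorphisms G"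
    by (simp add: graph_automorphisms_def id_Bij)
  then show "graph_automorphisms G \<noteq> {}" by blast
next
  fix f assume f: "f \<in> graph_automorphisms G"
  then have B: "f \<in> Bij (pverts G)" by (simp add: graph_automorphisms_def)
  have "(inv_into (pverts G) f u, inv_into (pverts G) f v) \<in> parcs G \<longleftrightarrow> (u, v) \<in> parcs G"
    if "u \<in> pverts G" "v \<in> pverts G" for u v
    using graph_automorphismD(4)[OF f Bij_inv_into_mem[OF B that(1)] Bij_inv_into_mem[OF B that(2)]]
      graph_automorphismD(1)[OF f] that by (simp add: bij_betw_inv_into_right)
  then show "inv\<^bsub>BijGroup (pverts G)\<^esub> f \<in> graph_automorphisms G"
    using restrict_inv_into_Bij[OF B] by (simp add: inv_BijGroup B graph_automorphisms_def)
next
  fix f g assume fg: "f \<in> graph_automorphisms G" "g \<in> graph_automorphisms G"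
  then show "f \<otimes>\<^bsub>BijGroup (pverts G)\<^esub> g \<in> graph_automorphisms G"
    using compose_graph_automorphisms[OF fg] by (simp add: BijGroup_def graph_automorphisms_def)
qed

lemma group_Aut_graph: "group (Aut_graph G)"
  unfolding Aut_graph_def
  by (rule subgroup.subgroup_is_group[OF subgroup_graph_automorphisms group_BijGroup])

lemma carrier_Aut_graph: "carrier (Aut_graph G) = graph_automorphisms G"
  by (simp add: Aut_graph_def)

lemma one_Aut_graph: "\<one>\<^bsub>Aut_graph G\<^esub> = (\<lambda>x\<in>pverts G. x)"
  by (simp add: Aut_graph_def BijGroup_def)

lemma mult_Aut_graph:
  assumes "f \<in> graph_automorphisms G" "g \<in> graph_automorphisms G"
  shows "f \<otimes>\<^bsub>Aut_graph G\<^esub> g = compose (pverts G) f g"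
  using assms by (simp add: Aut_graph_def BijGroup_def graph_automorphisms_def)

section \<open>The embedded symmetric group and its separation from complementation\<close>

lemma rho_hom: "johnson_rho n i \<in> hom (sym_group n) (Aut_graph (johnson_graph n i))"
proof (rule homI)
  fix \<theta> \<phi> assume "\<theta> \<in> carrier (sym_group n)" "\<phi> \<in> carrier (sym_group n)"
  then have p: "\<theta> permutes {1..n}" "\<phi> permutes {1..n}" by (simp_all add: sym_group_carrier)
  show "johnson_rho n i (\<theta> \<otimes>\<^bsub>sym_group n\<^esub> \<phi>) =
      johnson_rho n i \<theta> \<otimes>\<^bsub>Aut_graph (johnson_graph n i)\<^esub> johnson_rho n i \<phi>"
    unfolding sym_group_mult mult_Aut_graph[OF rho_automorphism[OF p(1)] rho_automorphism[OF p(2)]]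
    using image_vert[OF p(2)]
    by (auto simp: fun_eq_iff compose_def johnson_rho_def restrict_def image_comp)
qed (simp add: carrier_Aut_graph rho_automorphism sym_group_carrier)

lemma vert_between:
  assumes "P \<subseteq> Q" "Q \<subseteq> {1..n}" "card P \<le> i" "i \<le> card Q"
  obtains A where "A \<in> pverts (johnson_graph n i)" "P \<subseteq> A" "A \<subseteq> Q"
  using exists_subset_between[of P i Q] assms finite_subset[OF assms(2)]
  by (metis finite_atLeastAtMost johnson_verts_iff order_trans)

text \<open>If \<open>\<theta> x \<noteq> \<phi> x\<close>, let
  \<open>\<phi> y = \<theta> x\<close>. A vertex containing \<open>x\<close> but not
  \<open>y\<close> has \<open>\<theta> x\<close> in its image under \<open>\<theta>\<close> but not
  in its image under \<open>\<phi>\<close>; such a vertex exists because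
  \<open>0 < i < n\<close>.\<close>

lemma rho_inj:
  assumes i: "0 < i" "i < n"
  shows "inj_on (johnson_rho n i) (carrier (sym_group n))"
proof (rule inj_onI, rule ccontr)
  fix \<theta> \<phi> assume "\<theta> \<in> carrier (sym_group n)" "\<phi> \<in> carrier (sym_group n)"
    and eq: "johnson_rho n i \<theta> = johnson_rho n i \<phi>" and "\<theta> \<noteq> \<phi>"
  then have p: "\<theta> permutes {1..n}" "\<phi> permutes {1..n}" by (simp_all add: sym_group_carrier)
  obtain x where x: "\<theta> x \<noteq> \<phi> x" using \<open>\<theta> \<noteq> \<phi>\<close> by auto
  then have xU: "x \<in> {1..n}" using p by (metis permutes_def)
  define y where "y = inv' \<phi> (\<theta> x)"
  have y: "\<phi> y = \<theta> x" unfolding y_def using p(2) by (simp add: permutes_inverses(1))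
  have "y \<in> {1..n}" using xU p by (metis permutes_in_image y)
  then have cy: "card ({1..n} - {y}) = n - 1" by simp
  have xy: "x \<noteq> y" using x y by auto
  obtain A where A: "A \<in> pverts (johnson_graph n i)" "{x} \<subseteq> A" "A \<subseteq> {1..n} - {y}"
    by (rule vert_between[of "{x}" "{1..n} - {y}" n i]) (use xU xy cy i in auto)
  then have "\<theta> x \<in> \<phi> ` A" using fun_cong[OF eq, of A] by (auto simp: rho_apply)
  then obtain z where "z \<in> A" "\<phi> z = \<phi> y" using y by auto
  then show False using A(3) permutes_inj[OF p(2)] by (auto dest: injD)
qed

text \<open>A vertex containing both \<open>1\<close> and \<open>\<theta> 1\<close> meets its image
  under \<open>\<theta>\<close> in \<open>\<theta> 1\<close>, whereas it is disjoint from its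
  complement.\<close>

lemma compl_not_rho:
  assumes i: "2 \<le> i" "i \<le> n"
  shows "johnson_compl n i \<notin> johnson_rho n i ` carrier (sym_group n)"
proof
  assume "johnson_compl n i \<in> johnson_rho n i ` carrier (sym_group n)"
  then obtain \<theta> where \<theta>: "\<theta> permutes {1..n}" and eq: "johnson_compl n i = johnson_rho n i \<theta>"
    by (auto simp: sym_group_carrier)
  have "1 \<in> {1..n}" using i by simp
  then have "\<theta> 1 \<in> {1..n}" using permutes_in_image[OF \<theta>] by blast
  moreover have "card {1, \<theta> 1} \<le> 2" by (simp add: card_insert_if)
  ultimately obtain A where A: "A \<in> pverts (johnson_graph n i)" "{1, \<theta> 1} \<subseteq> A"
    using vert_between[of "{1, \<theta> 1}" "{1..n}" n i] i by auto
  then have "{1..n} - A = \<theta> ` A" using fun_cong[OF eq, of A] by (simp add: rho_apply compl_apply)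
  then show False using A(2) by blast
qed

section \<open>Classification of the automorphisms\<close>

text \<open>Injectivity and counting make \<open>\<sigma>\<close> and \<open>\<tau>\<close>
  bijections onto \<open>f A\<close> and its complement. They glue to a permutation
  \<open>\<theta>\<close> that acts like \<open>f\<close> on \<open>A\<close> and its neighbours,
  and rigidity extends the agreement to all vertices.\<close>

lemma straight_automorphism_is_rho:
  assumes f: "f \<in> graph_automorphisms (johnson_graph n i)" and i: "0 < i" "i < n"
    and V: "A \<in> pverts (johnson_graph n i)"
    and st: "\<And>a b. \<lbrakk>a \<in> A; b \<in> {1..n} - A\<rbrakk> \<Longrightarrow>
      \<sigma> a \<in> f A \<and> \<tau> b \<in> {1..n} - f A \<and> f (exchange A a b) = exchange (f A) (\<sigma> a) (\<tau> b)"
  shows "f \<in> johnson_rho n i ` carrier (sym_group n)"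
proof -
  let ?V = "pverts (johnson_graph n i)" and ?U = "{1..n}"
  note fD = graph_automorphismD[OF f]
  have fA: "f A \<in> ?V" using fD(3) V .
  have fin: "finite A" "finite (f A)" using V fA johnson_vert_finite by auto
  have cU: "card (?U - A) = n - i" "card (?U - f A) = n - i"
    using V fA fin by (auto simp: johnson_verts_iff card_Diff_subset)
  have "A \<noteq> {}" using V i by (auto simp: johnson_verts_iff)
  then obtain a0 where a0: "a0 \<in> A" by blast
  have "?U - A \<noteq> {}" using cU i by (metis card.empty less_numeral_extra(3) zero_less_diff)
  then obtain b0 where b0: "b0 \<in> ?U - A" by blast
  have f_inj: "a = a' \<and> b = b'" if "a \<in> A" "b \<in> ?U - A" "a' \<in> A" "b' \<in> ?U - A"
    "\<sigma> a = \<sigma> a'" "\<tau> b = \<tau> b'" for a b a' b'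
  proof -
    have "f (exchange A a b) = f (exchange A a' b')" using st that by metis
    then have "exchange A a b = exchange A a' b'"
      using fD(1) exchange_vert[OF V] that by (metis bij_betw_inv_into_left)
    then show ?thesis using exchange_eq_iff[of a A a' b b'] that by blast
  qed
  \<comment> \<open>Holding the other coordinate at \<open>b0\<close> turns the joint injectivity of
    \<open>\<sigma>\<close> and \<open>\<tau>\<close> into that of \<open>\<sigma>\<close>;
    \<open>a0\<close> does the same for \<open>\<tau>\<close> below.\<close>
  have "inj_on \<sigma> A" using f_inj[OF _ b0 _ b0] by (auto intro: inj_onI)
  moreover have "\<sigma> ` A \<subseteq> f A" using st b0 by blast
  ultimately have bs: "bij_betw \<sigma> A (f A)"
    using V fA fin by (simp add: bij_betw_def card_image card_subset_eq johnson_verts_iff)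
  have "inj_on \<tau> (?U - A)" using f_inj[OF a0 _ a0] by (auto intro: inj_onI)
  moreover have "\<tau> ` (?U - A) \<subseteq> ?U - f A" using st a0 by blast
  ultimately have bt: "bij_betw \<tau> (?U - A) (?U - f A)"
    using cU by (simp add: bij_betw_def card_image card_subset_eq)
  \<comment> \<open>The last branch is the identity outside \<open>{1..n}\<close>, as
    \<open>permutes\<close> demands.\<close>
  define \<theta> where "\<theta> x = (if x \<in> A then \<sigma> x else if x \<in> ?U then \<tau> x else x)" for x
  have AU: "A \<subseteq> ?U" "f A \<subseteq> ?U" using V fA by (auto simp: johnson_verts_iff)
  have b1: "bij_betw \<theta> A (f A)"
    using bs by (rule bij_betw_cong[THEN iffD1, rotated]) (simp add: \<theta>_def)
  have b2: "bij_betw \<theta> (?U - A) (?U - f A)"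
    using bt by (rule bij_betw_cong[THEN iffD1, rotated]) (simp add: \<theta>_def)
  have "bij_betw \<theta> (A \<union> (?U - A)) (f A \<union> (?U - f A))"
    by (rule bij_betw_combine[OF b1 b2]) auto
  moreover have "A \<union> (?U - A) = ?U" "f A \<union> (?U - f A) = ?U" using AU by auto
  ultimately have "bij_betw \<theta> ?U ?U" by simp
  then have \<theta>: "\<theta> permutes ?U"
    by (rule bij_imp_permutes) (use AU in \<open>auto simp: \<theta>_def\<close>)
  have \<theta>A: "\<theta> ` A = f A" using b1 by (simp add: bij_betw_def)
  have \<theta>B: "\<theta> ` B = f B" if arc: "(A, B) \<in> parcs (johnson_graph n i)" for B
  proof -
    obtain a b where ab: "a \<in> A" "b \<in> ?U - A" "B = exchange A a b" by (rule johnson_arcE[OF arc])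
    have "\<theta> ` B = insert (\<theta> b) (\<theta> ` A - {\<theta> a})"
      using permutes_inj[OF \<theta>] by (simp add: ab image_set_diff)
    also have "\<dots> = exchange (f A) (\<sigma> a) (\<tau> b)" using ab \<theta>A by (simp add: \<theta>_def)
    finally show ?thesis using st ab by simp
  qed
  \<comment> \<open>Following \<open>f\<close> by the inverse of \<open>\<theta>\<close> gives an
    automorphism that fixes \<open>A\<close> and its neighbours, so rigidity applies to it.\<close>
  let ?k = "compose ?V (johnson_rho n i (inv' \<theta>)) f"
  have inv: "inv' \<theta> ` \<theta> ` X = X" for X
    by (simp add: image_comp permutes_inv_o[OF \<theta>])
  have inv': "\<theta> ` inv' \<theta> ` X = X" for X
    by (simp add: image_comp permutes_inv_o[OF \<theta>])
  have kapp: "?k X = inv' \<theta> ` f X" if "X \<in> ?V" for X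
    using that fD(3) by (simp add: compose_eq rho_apply)
  have "?k X = X" if "X \<in> ?V" for X
  proof (rule automorphism_rigid[OF _ V _ _ that])
    show "?k \<in> graph_automorphisms (johnson_graph n i)"
      by (rule compose_graph_automorphisms[OF rho_automorphism f]) (rule permutes_inv[OF \<theta>])
    show "?k A = A" using kapp[OF V] inv[of A] by (simp add: \<theta>A)
    show "?k B = B" if "(A, B) \<in> parcs (johnson_graph n i)" for B
      using kapp[of B] inv[of B] \<theta>B[OF that] that by (simp add: johnson_graph_arc_iff)
  qed
  then have "f X = \<theta> ` X" if "X \<in> ?V" for X
    using kapp[OF that] inv'[of "f X"] that by simp
  then have "f = johnson_rho n i \<theta>"
    using fD(2) by (auto simp: fun_eq_iff johnson_rho_def extensional_def)
  then show ?thesis using \<theta> by (auto simp: sym_group_carrier)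
qed

text \<open>In the grids at \<open>A\<close> and \<open>f A\<close>, \<open>f\<close> acts straight
  or crossed. The straight case gives an induced permutation at once; in the crossed case
  complementation after \<open>f\<close> is straight.\<close>

lemma automorphism_cases:
  assumes f: "f \<in> graph_automorphisms (johnson_graph n i)" and i: "2 \<le> i" and n: "n = 2 * i"
  shows "f \<in> johnson_rho n i ` carrier (sym_group n) \<or>
    compose (pverts (johnson_graph n i)) (johnson_compl n i) f \<in> johnson_rho n i ` carrier (sym_group n)"
proof -
  let ?V = "pverts (johnson_graph n i)" and ?U = "{1..n}"
  note fD = graph_automorphismD[OF f]
  have i': "0 < i" "i < n" using i n by auto
  define A where "A = {1..i}"
  have V: "A \<in> ?V" using n by (auto simp: A_def johnson_verts_iff)
  have fA: "f A \<in> ?V" using fD(3) V .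
  \<comment> \<open>The dichotomy for grid maps asks for one element of \<open>A\<close> and two
    outside it; the latter exist because \<open>n - i = i \<ge> 2\<close>.\<close>
  have mem: "1 \<in> A" "i + 1 \<in> ?U - A" "i + 2 \<in> ?U - A" using i n by (auto simp: A_def)
  have "\<exists>c d. c \<in> f A \<and> d \<in> ?U - f A \<and> f (exchange A a b) = exchange (f A) c d"
    if ab: "a \<in> A" "b \<in> ?U - A" for a b
  proof -
    have "(f A, f (exchange A a b)) \<in> parcs (johnson_graph n i)"
      using fD(4)[OF V exchange_vert[OF V ab]] exchange_arc[OF V ab] by simp
    then show ?thesis by (rule johnson_arcE) blast
  qed
  then obtain g h where gh: "\<And>a b. \<lbrakk>a \<in> A; b \<in> ?U - A\<rbrakk> \<Longrightarrow> g a b \<in> f A \<and> h a b \<in> ?U - f A \<and>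
      f (exchange A a b) = exchange (f A) (g a b) (h a b)"
    by metis
  have adj: "((g a b = g a' b') \<noteq> (h a b = h a' b')) \<longleftrightarrow> ((a = a') \<noteq> (b = b'))"
    if "a \<in> A" "b \<in> ?U - A" "a' \<in> A" "b' \<in> ?U - A" for a b a' b'
    using fD(4)[OF exchange_vert[OF V that(1,2)] exchange_vert[OF V that(3,4)]]
      exchange_exchange_arc_iff[OF V that]
      exchange_exchange_arc_iff[OF fA, of "g a b" "h a b" "g a' b'" "h a' b'"]
      gh[OF that(1,2)] gh[OF that(3,4)] by simp
  have inj: "a = a' \<and> b = b'"
    if "a \<in> A" "b \<in> ?U - A" "a' \<in> A" "b' \<in> ?U - A" "g a b = g a' b'" "h a b = h a' b'" for a b a' b'
  proof -
    have "f (exchange A a b) = f (exchange A a' b')"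
      using gh[OF that(1,2)] gh[OF that(3,4)] that by simp
    then have "exchange A a b = exchange A a' b'"
      using fD(1) exchange_vert[OF V] that by (metis bij_betw_inv_into_left)
    then show ?thesis using exchange_eq_iff[of a A a' b b'] that by blast
  qed
  have "i + 1 \<noteq> i + 2" by simp
  from adj inj mem this show ?thesis
  proof (rule grid_map_cases[of A "?U - A" g h])
    fix \<sigma> \<tau> assume "\<And>a b. a \<in> A \<Longrightarrow> b \<in> ?U - A \<Longrightarrow> g a b = \<sigma> a \<and> h a b = \<tau> b"
    then have "f \<in> johnson_rho n i ` carrier (sym_group n)"
      using gh by (intro straight_automorphism_is_rho[OF f i' V, of \<sigma> \<tau>]) metis
    then show ?thesis ..
  next
    fix \<sigma> \<tau> assume cr: "\<And>a b. a \<in> A \<Longrightarrow> b \<in> ?U - A \<Longrightarrow> h a b = \<sigma> a \<and> g a b = \<tau> b"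
    let ?k = "compose ?V (johnson_compl n i) f"
    have kapp: "?k X = ?U - f X" if "X \<in> ?V" for X
      using that fD(3) by (simp add: compose_eq compl_apply)
    have "?k \<in> johnson_rho n i ` carrier (sym_group n)"
    proof (rule straight_automorphism_is_rho[OF _ i' V])
      show "?k \<in> graph_automorphisms (johnson_graph n i)"
        by (rule compose_graph_automorphisms[OF compl_automorphism[OF n] f])
      fix a b assume ab: "a \<in> A" "b \<in> ?U - A"
      have fAU: "f A \<subseteq> ?U" using fA by (simp add: johnson_verts_iff)
      have m: "\<sigma> a \<in> ?U - f A" "\<tau> b \<in> f A" "f (exchange A a b) = exchange (f A) (\<tau> b) (\<sigma> a)"
        using gh[OF ab] cr[OF ab] by auto
      \<comment> \<open>Complementation interchanges the removed and the inserted element, which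
        straightens the crossed coordinates.\<close>
      have "?U - exchange (f A) (\<tau> b) (\<sigma> a) = exchange (?U - f A) (\<sigma> a) (\<tau> b)"
        using m(1,2) fAU by auto
      then show "\<sigma> a \<in> ?k A \<and> \<tau> b \<in> ?U - ?k A \<and>
          ?k (exchange A a b) = exchange (?k A) (\<sigma> a) (\<tau> b)"
        using m fAU kapp[OF V] kapp[OF exchange_vert[OF V ab]] by auto
    qed
    then show ?thesis ..
  qed
qed

section \<open>Relations between complementation and the induced permutations\<close>

lemma compl_compose_self:
  assumes "n = 2 * i"
  shows "compose (pverts (johnson_graph n i)) (johnson_compl n i) (johnson_compl n i)
    = (\<lambda>A\<in>pverts (johnson_graph n i). A)"
  using compl_vert[OF assms]
  by (auto simp: fun_eq_iff compose_def compl_apply johnson_verts_iff)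

lemma compl_rho_commute:
  assumes \<theta>: "\<theta> permutes {1..n}" and n: "n = 2 * i"
  shows "compose (pverts (johnson_graph n i)) (johnson_compl n i) (johnson_rho n i \<theta>)
    = compose (pverts (johnson_graph n i)) (johnson_rho n i \<theta>) (johnson_compl n i)"
proof -
  have "\<theta> ` ({1..n} - A) = {1..n} - \<theta> ` A" for A
    using permutes_image[OF \<theta>] permutes_inj[OF \<theta>] by (simp add: image_set_diff)
  then show ?thesis
    using compl_vert[OF n] image_vert[OF \<theta>]
    by (intro ext) (simp add: compose_def compl_apply rho_apply del: One_nat_def)
qed

section \<open>The direct product decomposition\<close>

lemma (in group) generate_involution:
  assumes "t \<in> carrier G" "t \<otimes> t = \<one>"
  shows "generate G {t} = {\<one>, t}"
proof
  have "inv t = t" using assms inv_equality by blast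
  then have "subgroup {\<one>, t} G" using assms by (intro subgroupI) auto
  then show "generate G {t} \<subseteq> {\<one>, t}" by (rule generate_subgroup_incl[rotated]) simp
  show "{\<one>, t} \<subseteq> generate G {t}" by (auto intro: generate.one generate.incl)
qed

text \<open>Write \<open>x = h \<otimes> k\<close>. On \<open>H\<close>, conjugation by
  \<open>k\<close> is trivial and conjugation by \<open>h\<close> stays inside; on \<open>K\<close>,
  conjugation by \<open>k\<close> stays inside and conjugation by \<open>h\<close> is
  trivial.\<close>

lemma (in group) normal_factor:
  assumes H: "subgroup H G" and K: "subgroup K G" and HK: "H <#> K = carrier G"
    and comm: "\<And>h k. h \<in> H \<Longrightarrow> k \<in> K \<Longrightarrow> h \<otimes> k = k \<otimes> h"
  shows "H \<lhd> G" "K \<lhd> G"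
proof -
  have conj: "x \<otimes> y \<otimes> inv x = y" if "x \<in> carrier G" "y \<in> carrier G" "x \<otimes> y = y \<otimes> x" for x y
    using that by (simp add: m_assoc)
  have mem: "h \<in> carrier G" "k \<in> carrier G" if "h \<in> H" "k \<in> K" for h k
    using that subgroup.mem_carrier[OF H] subgroup.mem_carrier[OF K] by auto
  have "x \<otimes> y \<otimes> inv x \<in> H" if x: "x \<in> carrier G" and y: "y \<in> H" for x y
  proof -
    obtain h k where hk: "h \<in> H" "k \<in> K" "x = h \<otimes> k"
      using x HK unfolding set_mult_def by blast
    have "x \<otimes> y \<otimes> inv x = h \<otimes> (k \<otimes> y \<otimes> inv k) \<otimes> inv h"
      using mem hk y mem(1)[OF y hk(2)] by (simp add: inv_mult_group m_assoc)
    also have "k \<otimes> y \<otimes> inv k = y"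
      by (rule conj[OF mem(2)[OF y hk(2)] mem(1)[OF y hk(2)] comm[OF y hk(2), symmetric]])
    finally show ?thesis
      using hk y H by (simp add: subgroup.m_closed subgroup.m_inv_closed)
  qed
  with H show "H \<lhd> G" by (simp add: normal_inv_iff)
  have "x \<otimes> y \<otimes> inv x \<in> K" if x: "x \<in> carrier G" and y: "y \<in> K" for x y
  proof -
    obtain h k where hk: "h \<in> H" "k \<in> K" "x = h \<otimes> k"
      using x HK unfolding set_mult_def by blast
    have kyk: "k \<otimes> y \<otimes> inv k \<in> K"
      using hk y K by (simp add: subgroup.m_closed subgroup.m_inv_closed)
    have "x \<otimes> y \<otimes> inv x = h \<otimes> (k \<otimes> y \<otimes> inv k) \<otimes> inv h"
      using mem hk y mem(2)[OF hk(1) y] by (simp add: inv_mult_group m_assoc)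
    also have "\<dots> = k \<otimes> y \<otimes> inv k" using conj mem[OF hk(1) kyk] comm[OF hk(1) kyk] by simp
    finally show ?thesis using kyk by simp
  qed
  with K show "K \<lhd> G" by (simp add: normal_inv_iff)
qed

theorem theorem1:
  fixes i n :: nat
  assumes "i \<ge> 3" and "n = 2 * i"
  defines "Aut \<equiv> Aut_graph (johnson_graph n i)"
    and "S \<equiv> johnson_rho n i ` carrier (sym_group n)"
    and "T \<equiv> johnson_compl n i"
  shows "johnson_rho n i \<in> iso (sym_group n) (Aut\<lparr>carrier := S\<rparr>) \<and>
         internal_direct_product Aut S (generate Aut {T})"
proof
  let ?V = "pverts (johnson_graph n i)"
  interpret Aut: group Aut unfolding Aut_def by (rule group_Aut_graph)
  have hom: "johnson_rho n i \<in> hom (sym_group n) Aut" unfolding Aut_def by (rule rho_hom)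
  have "inj_on (johnson_rho n i) (carrier (sym_group n))" using assms(1,2) by (intro rho_inj) auto
  with hom show "johnson_rho n i \<in> iso (sym_group n) (Aut\<lparr>carrier := S\<rparr>)"
    by (auto simp: iso_def hom_def bij_betw_def S_def)
  have SG: "subgroup S Aut"
    unfolding S_def
    by (rule group_hom.img_is_subgroup)
      (simp add: group_hom_def group_hom_axioms_def hom sym_group_is_group Aut.is_group)
  have TA: "T \<in> graph_automorphisms (johnson_graph n i)"
    unfolding T_def by (rule compl_automorphism[OF assms(2)])
  then have TC: "T \<in> carrier Aut" by (simp add: Aut_def carrier_Aut_graph)
  have TT: "T \<otimes>\<^bsub>Aut\<^esub> T = \<one>\<^bsub>Aut\<^esub>"
    unfolding Aut_def mult_Aut_graph[OF TA TA] one_Aut_graph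
    unfolding T_def by (rule compl_compose_self[OF assms(2)])
  have gen: "generate Aut {T} = {\<one>\<^bsub>Aut\<^esub>, T}" by (rule Aut.generate_involution[OF TC TT])
  have KG: "subgroup (generate Aut {T}) Aut" using TC by (intro Aut.generate_is_subgroup) simp
  have comm: "h \<otimes>\<^bsub>Aut\<^esub> k = k \<otimes>\<^bsub>Aut\<^esub> h" if h: "h \<in> S" and k: "k \<in> generate Aut {T}" for h k
  proof -
    have hC: "h \<in> carrier Aut" using h SG by (rule subgroup.mem_carrier[rotated])
    obtain \<theta> where \<theta>: "\<theta> permutes {1..n}" "h = johnson_rho n i \<theta>"
      using h unfolding S_def image_iff Bex_def sym_group_carrier by blast
    have "h \<otimes>\<^bsub>Aut\<^esub> T = T \<otimes>\<^bsub>Aut\<^esub> h"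
      using compl_rho_commute[OF \<theta>(1) assms(2)] TA rho_automorphism[OF \<theta>(1), of i]
      by (simp add: Aut_def mult_Aut_graph \<theta>(2)) (simp add: T_def)
    then show ?thesis using k hC by (auto simp: gen)
  qed
  have "f \<in> S <#>\<^bsub>Aut\<^esub> generate Aut {T}" if fC: "f \<in> carrier Aut" for f
  proof -
    have f: "f \<in> graph_automorphisms (johnson_graph n i)"
      using fC by (simp add: Aut_def carrier_Aut_graph)
    have "f \<in> S \<or> T \<otimes>\<^bsub>Aut\<^esub> f \<in> S"
      using automorphism_cases[OF f _ assms(2)] assms(1) mult_Aut_graph[OF TA f]
      by (simp add: Aut_def S_def T_def)
    then show ?thesis
    proof
      assume "f \<in> S"
      moreover have "f = f \<otimes>\<^bsub>Aut\<^esub> \<one>\<^bsub>Aut\<^esub>" using fC by simp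
      ultimately show ?thesis unfolding set_mult_def gen by blast
    next
      assume S: "T \<otimes>\<^bsub>Aut\<^esub> f \<in> S"
      \<comment> \<open>Since \<open>T\<close> is an involution commuting with every element of
        \<open>S\<close>, \<open>f = T (T f) = (T f) T\<close> with \<open>T f\<close> in
        \<open>S\<close>.\<close>
      have "f = (T \<otimes>\<^bsub>Aut\<^esub> T) \<otimes>\<^bsub>Aut\<^esub> f" using fC TT by simp
      also have "\<dots> = T \<otimes>\<^bsub>Aut\<^esub> (T \<otimes>\<^bsub>Aut\<^esub> f)" using fC TC by (simp only: Aut.m_assoc)
      also have "\<dots> = (T \<otimes>\<^bsub>Aut\<^esub> f) \<otimes>\<^bsub>Aut\<^esub> T" using comm[OF S, of T] by (simp add: gen)
      finally show ?thesis using S unfolding set_mult_def gen by blast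
    qed
  qed
  moreover have "S <#>\<^bsub>Aut\<^esub> generate Aut {T} \<subseteq> carrier Aut"
    by (rule Aut.setmult_subset_G[OF subgroup.subset[OF SG] subgroup.subset[OF KG]])
  ultimately have prod: "S <#>\<^bsub>Aut\<^esub> generate Aut {T} = carrier Aut" by blast
  \<comment> \<open>The second factor is just the identity and \<open>T\<close>, so this alone makes
    the intersection trivial.\<close>
  have "T \<notin> S" unfolding T_def S_def using assms(1,2) by (intro compl_not_rho) auto
  then have "S \<inter> generate Aut {T} = {\<one>\<^bsub>Aut\<^esub>}"
    using subgroup.one_closed[OF SG] by (auto simp: gen)
  then show "internal_direct_product Aut S (generate Aut {T})"
    unfolding internal_direct_product_def
    using Aut.normal_factor[OF SG KG prod comm] prod by simp
qed

end
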